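(* Let $n\ge 1$ and define $\varphi=\mathcal{F}\circ\mathcal{I}\circ\mathcal{F}^{-1}\circ\mathcal{R}$ and $\overline{\varphi}=\mathcal{I}\circ\mathcal{F}^{-1}\circ\mathcal{R}\circ\mathcal{F}$, both bijections $\mathfrak{S}_n\to\mathfrak{S}_n$ (so $\overline{\varphi}=\mathcal{F}^{-1}\varphi\mathcal{F}$). Then: (1) Every $\varphi$-orbit (equivalently every $\overline{\varphi}$-orbit) in $\mathfrak{S}_n$ has size a power of $2$. Specifically, if $w$ lies in a $\varphi$-orbit and $h$ is the height of the heap $H(w)$ (the number of edges in a longest path from the root to a leaf), then the orbit has size $2^h$. Consequently the greatest common divisor of the $\varphi$-orbit sizes on $\mathfrak{S}_n$ is the greatest power of $2$ that is less than or equal to $n$. (2) The statistic $\mathrm{Fix}$ (number of fixed points, i.e. $1$-cycles, of a permutation) is $1$-mesic with respect to $\overline{\varphi}$. Equivalently, the statistic $\mathrm{Rasc}$ is $1$-mesic with respect to $\varphi$, where for $u\in\mathfrak{S}_n$ in one-line notation, $\mathrm{Rasc}(u)$ is the number of records of $u$ that are immediately followed by another record or are in the final position. (3) For fixed $i\neq j$ in $[n]$, let $\mathbb{1}_{i<j}(u)$ be $1$ if $i$ occurs to the left of $j$ in the one-line notation of $u$ and $0$ otherwise. Then $\mathbb{1}_{i<j}$ is $\tfrac12$-mesic with respect to $\varphi$. (4) For fixed $i\in[n-1]$, let $\mathbb{1}_{(i,n)}(w)$ be $1$ if $i$ and $n$ lie in the same cycle of $w$ and $0$ otherwise. Then $\mathbb{1}_{(i,n)}$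 is $\tfrac12$-mesic with respect to $\overline{\varphi}$.
   Context: $\mathfrak{S}_n$ is the set of permutations of $[n]=\{1,\dots,n\}$. A record of a word $w_1\cdots w_n$ is a left-to-right maximum, i.e. an entry $w_i$ larger than all $w_k$ with $k<i$. The canonical cycle decomposition (CCD) of $w\in\mathfrak{S}_n$ writes $w$ as disjoint cycles, each cycle written with its largest element first, and the cycles ordered by increasing first elements. The Rényi–Foata map $\mathcal{F}:\mathfrak{S}_n\to\mathfrak{S}_n$ deletes the parentheses in the CCD of $w$ and reads the resulting word as a permutation in one-line notation; it is a bijection (its inverse places a left parenthesis before each record of a one-line word and closes cycles accordingly). $\mathcal{R}$ is reversal: $\mathcal{R}(w)_i=w_{n+1-i}$. $\mathcal{I}$ is inversion $w\mapsto w^{-1}$. The heap $H(w)$ of a word $w$ with distinct entries from a totally ordered set is defined recursively: $H(\emptyset)$ is the empty tree; otherwise write $w=umv$ with $m$ the largest entry, make $m$ the root, $H(u)$ its left subtree and $H(v)$ its right subtree. For an invertible map $\tau$ on a finite set $S$ and a statistic $f:S\to\mathbb{Q}$, $f$ is $c$-mesic with respect to $\tau$ if for every $\tau$-orbit $\mathcal{O}$, $\frac{1}{\#\mathcal{O}}\sum_{x\in\mathcal{O}}f(x)=c$. *)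

theory Defs
  imports
    Complex_Main
    "HOL-Combinatorics.Permutations"
    "HOL-Combinatorics.Cycles"
    "HOL-Combinatorics.Orbits"
    "HOL-Library.Tree"
begin

text \<open>Permutations of \<open>[n]\<close> are functions on \<open>nat\<close> that permute \<open>{1..n}\<close> and are the
  identity elsewhere; inversion is therefore the library's \<open>inv\<close>.\<close>

definition Sym :: "nat \<Rightarrow> (nat \<Rightarrow> nat) set" where
  "Sym n = {w. w permutes {1..n}}"

definition one_line :: "nat \<Rightarrow> (nat \<Rightarrow> nat) \<Rightarrow> nat list" where
  "one_line n w = map w [1..<Suc n]"

text \<open>Positions of words count from 1, whereas list indices count from 0.\<close>

definition of_one_line :: "nat list \<Rightarrow> (nat \<Rightarrow> nat)" where
  "of_one_line xs = (\<lambda>i. if i \<in> {1..length xs} then xs ! (i - 1) else i)"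

definition reversal :: "nat \<Rightarrow> (nat \<Rightarrow> nat) \<Rightarrow> (nat \<Rightarrow> nat)" where
  "reversal n w = (\<lambda>i. if i \<in> {1..n} then w (n + 1 - i) else i)"

text \<open>\<open>support w m\<close> is the cycle \<open>[m, w m, w (w m), \<dots>]\<close> of \<open>w\<close> written starting from \<open>m\<close>;
  it is \<open>[m]\<close> if \<open>m\<close> is a fixed point.\<close>

definition ccd :: "nat \<Rightarrow> (nat \<Rightarrow> nat) \<Rightarrow> nat list list" where
  "ccd n w = map (support w) (sorted_list_of_set {m \<in> {1..n}. m = Max (orbit w m)})"

definition renyi_foata :: "nat \<Rightarrow> (nat \<Rightarrow> nat) \<Rightarrow> (nat \<Rightarrow> nat)" where
  "renyi_foata n w = of_one_line (concat (ccd n w))"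

definition renyi_foata_inv :: "nat \<Rightarrow> (nat \<Rightarrow> nat) \<Rightarrow> (nat \<Rightarrow> nat)" where
  "renyi_foata_inv n = inv_into (Sym n) (renyi_foata n)"

definition phi :: "nat \<Rightarrow> (nat \<Rightarrow> nat) \<Rightarrow> (nat \<Rightarrow> nat)" where
  "phi n = renyi_foata n \<circ> inv \<circ> renyi_foata_inv n \<circ> reversal n"

definition phi_bar :: "nat \<Rightarrow> (nat \<Rightarrow> nat) \<Rightarrow> (nat \<Rightarrow> nat)" where
  "phi_bar n = inv \<circ> renyi_foata_inv n \<circ> reversal n \<circ> renyi_foata n"

function (sequential) heap_of :: "'a::linorder list \<Rightarrow> 'a tree" where
  "heap_of [] = Leaf"
| "heap_of w = (let m = Max (set w) in
     Node (heap_of (takeWhile (\<lambda>x. x \<noteq> m) w)) m (heap_of (tl (dropWhile (\<lambda>x. x \<noteq> m) w))))"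
  by pat_completeness auto
termination
proof (relation "measure length", goal_cases)
  case (2 x xs m)
  have "m \<in> set (x # xs)" unfolding 2 by (rule Max_in) auto
  then have "dropWhile (\<lambda>y. y \<noteq> m) (x # xs) \<noteq> []"
    by (auto simp only: dropWhile_eq_Nil_conv)
  moreover have "length (takeWhile (\<lambda>y. y \<noteq> m) (x # xs)) +
      length (dropWhile (\<lambda>y. y \<noteq> m) (x # xs)) = length (x # xs)"
    by (simp only: length_append [symmetric] takeWhile_dropWhile_id)
  ultimately show ?case
    unfolding in_measure length_greater_0_conv[symmetric] by linarith
next
  case (3 x xs m)
  have "length (dropWhile (\<lambda>y. y \<noteq> m) (x # xs)) \<le> length (x # xs)"
    by (rule length_dropWhile_le)
  then show ?case by (simp del: dropWhile.simps length_Cons)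
qed simp

text \<open>The constructor \<open>Leaf\<close> is the empty tree, so the leaves in the usual sense are the nodes
  both of whose subtrees are \<open>Leaf\<close>. The height below counts edges between nodes; it is one less
  than the library's \<open>height\<close> on nonempty trees and is not meaningful on the empty tree.\<close>

fun leaf_depths :: "'a tree \<Rightarrow> nat set" where
  "leaf_depths Leaf = {}"
| "leaf_depths (Node l a r) =
     (if l = Leaf \<and> r = Leaf then {0} else Suc ` (leaf_depths l \<union> leaf_depths r))"

definition edge_height :: "'a tree \<Rightarrow> nat" where
  "edge_height t = Max (leaf_depths t)"

text \<open>\<open>orbit \<tau> x\<close> consists of the forward iterates \<open>(\<tau> ^^ k) x\<close> with \<open>k > 0\<close>; as \<open>\<tau>\<close> is a
  bijection of the finite set \<open>S\<close>, this is the full orbit of \<open>x\<close> and contains \<open>x\<close>.\<close>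

definition mesic :: "rat \<Rightarrow> ('a \<Rightarrow> 'a) \<Rightarrow> 'a set \<Rightarrow> ('a \<Rightarrow> rat) \<Rightarrow> bool" where
  "mesic c \<tau> S f \<longleftrightarrow> finite S \<and> bij_betw \<tau> S S \<and>
     (\<forall>x\<in>S. (\<Sum>y\<in>orbit \<tau> x. f y) / of_nat (card (orbit \<tau> x)) = c)"

definition Fix :: "nat \<Rightarrow> (nat \<Rightarrow> nat) \<Rightarrow> nat" where
  "Fix n w = card {i \<in> {1..n}. w i = i}"

definition record_at :: "(nat \<Rightarrow> nat) \<Rightarrow> nat \<Rightarrow> bool" where
  "record_at u p \<longleftrightarrow> (\<forall>k\<in>{1..<p}. u k < u p)"

definition Rasc :: "nat \<Rightarrow> (nat \<Rightarrow> nat) \<Rightarrow> nat" where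
  "Rasc n u = card {p \<in> {1..n}. record_at u p \<and> (p = n \<or> record_at u (p + 1))}"

definition left_of :: "nat \<Rightarrow> nat \<Rightarrow> nat \<Rightarrow> (nat \<Rightarrow> nat) \<Rightarrow> bool" where
  "left_of n i j u \<longleftrightarrow> (\<exists>p q. 1 \<le> p \<and> p < q \<and> q \<le> n \<and> u p = i \<and> u q = j)"

definition same_cycle :: "nat \<Rightarrow> nat \<Rightarrow> (nat \<Rightarrow> nat) \<Rightarrow> bool" where
  "same_cycle i j w \<longleftrightarrow> j \<in> orbit w i"

end

theory Submission
  imports Defs
begin

text \<open>
  Write a word as \<open>w = u m v\<close> with largest entry \<open>m\<close>. Reversal gives \<open>v\<^sup>R m u\<^sup>R\<close>, whose last cycle under
  the inverse Renyi-Foata map is \<open>(m u\<^sup>R)\<close>, with inverse \<open>(m u)\<close>, so \<open>\<phi>(u m v) = \<phi>(v) m u\<close>. On heaps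
  \<open>\<phi>\<close> is therefore the recursive map \<open>twist\<close>, and
  \<open>\<phi>\<^bsup>2k\<^esup>(u m v) = \<phi>\<^bsup>k\<^esup>(u) m \<phi>\<^bsup>k\<^esup>(v)\<close>, \<open>\<phi>\<^bsup>2k+1\<^esup>(u m v) = \<phi>\<^bsup>k+1\<^esup>(v) m \<phi>\<^bsup>k\<^esup>(u)\<close>.
  Hence the period of a heap with more than one node is twice the larger of the periods of its two
  subtrees. Splitting a sum over \<open>2\<^bsup>K+1\<^esup>\<close> iterates into even and odd ones yields the averages by the
  same recursion. The map \<open>\<F>\<close> conjugates the second action into the first, turning fixed points
  into the records counted by \<open>Rasc\<close> and the cycle of \<open>n\<close> into the part of the word starting at \<open>n\<close>.
\<close>

section \<open>The twist of a decreasing tree\<close>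

fun twist :: "'a tree \<Rightarrow> 'a tree" where
  "twist Leaf = Leaf"
| "twist (Node l m r) = Node (twist r) m l"

text \<open>Disjoint subtrees and the strict bound at the root force distinct labels, so these trees
  are exactly the heaps of words without repeated entries.\<close>

fun decreasing :: "'a::linorder tree \<Rightarrow> bool" where
  "decreasing Leaf \<longleftrightarrow> True"
| "decreasing (Node l m r) \<longleftrightarrow> decreasing l \<and> decreasing r \<and>
     (\<forall>x\<in>set_tree l \<union> set_tree r. x < m) \<and> set_tree l \<inter> set_tree r = {}"

lemma set_tree_twist [simp]: "set_tree (twist t) = set_tree t"
  by (induction t) auto

lemma twist_eq_Leaf_iff [simp]: "twist t = Leaf \<longleftrightarrow> t = Leaf"
  by (cases t) auto

lemma decreasing_twist [simp]: "decreasing (twist t) = decreasing t"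
  by (induction t) auto

lemma inj_twist: "inj twist"
proof (rule injI)
  fix s t :: "'a tree"
  assume "twist s = twist t"
  then show "s = t"
    by (induction s arbitrary: t) (metis twist_eq_Leaf_iff, case_tac t, auto)
qed

lemma set_tree_funpow_twist [simp]: "set_tree ((twist ^^ k) t) = set_tree t"
  by (induction k) auto

lemma funpow_twist_eq_Leaf_iff [simp]: "(twist ^^ k) t = Leaf \<longleftrightarrow> t = Leaf"
  by (induction k) auto

lemma funpow_twist_Leaf [simp]: "(twist ^^ k) Leaf = Leaf"
  by simp

text \<open>Two twists put each subtree back on its side, twisted once.\<close>

lemma funpow_twist_even:
  "(twist ^^ (2 * k)) (Node l m r) = Node ((twist ^^ k) l) m ((twist ^^ k) r)"
  by (induction k) auto

lemma funpow_twist_odd: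
  "(twist ^^ Suc (2 * k)) (Node l m r) = Node ((twist ^^ Suc k) r) m ((twist ^^ k) l)"
  using funpow_twist_even[of k l m r] by simp

text \<open>Unless both subtrees are empty, even iterates act on them at half speed and odd iterates
  exchange their label sets, so the period is twice that of the taller subtree. Truncated
  subtraction gives the empty tree period 1.\<close>

lemma funpow_twist_eq_self_iff:
  assumes "decreasing t"
  shows "(twist ^^ N) t = t \<longleftrightarrow> 2 ^ (height t - 1) dvd N"
  using assms
proof (induction t arbitrary: N)
  case (Node l m r)
  show ?case
  proof (cases "l = Leaf \<and> r = Leaf")
    case True
    have "(twist ^^ N) (Node Leaf m Leaf) = Node Leaf m Leaf"
      by (induction N) auto
    with True show ?thesis by simp
  next
    case False
    define h where "h = max (height l) (height r)"
    have "h > 0"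
      using False by (cases l; cases r) (auto simp: h_def)
    then obtain h' where h': "h = Suc h'" by (cases h) auto
    show ?thesis
    proof (cases "even N")
      case True
      then obtain k where N: "N = 2 * k" by blast
      have "(twist ^^ N) (Node l m r) = Node l m r \<longleftrightarrow>
          2 ^ (height l - 1) dvd k \<and> 2 ^ (height r - 1) dvd k"
        using Node unfolding N funpow_twist_even by simp
      \<comment> \<open>Powers of two form a chain under divisibility, so the condition of the
        taller subtree implies the other one.\<close>
      also have "\<dots> \<longleftrightarrow> 2 ^ (h - 1) dvd k"
      proof (cases "height l \<le> height r")
        case True
        then have "(2 :: nat) ^ (height l - 1) dvd 2 ^ (height r - 1)"
          by (intro le_imp_power_dvd) simp
        with True show ?thesis unfolding h_def by (auto dest: dvd_trans)
      next
        case False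
        then have "(2 :: nat) ^ (height r - 1) dvd 2 ^ (height l - 1)"
          by (intro le_imp_power_dvd) simp
        with False show ?thesis unfolding h_def by (auto dest: dvd_trans)
      qed
      also have "\<dots> \<longleftrightarrow> 2 ^ h dvd N"
        unfolding N h' by simp
      finally show ?thesis by (simp add: h_def)
    next
      case False
      then obtain k where N: "N = Suc (2 * k)" by (metis oddE Suc_eq_plus1)
      \<comment> \<open>Disjoint sets that coincide would both be empty.\<close>
      have "set_tree l \<noteq> set_tree r"
        using Node.prems \<open>\<not> (l = Leaf \<and> r = Leaf)\<close> by (auto simp: eq_set_tree_empty)
      then have "(twist ^^ N) (Node l m r) \<noteq> Node l m r"
        unfolding N funpow_twist_odd by (metis tree.inject set_tree_funpow_twist)
      \<comment> \<open>Here \<open>h > 0\<close> makes \<open>2 ^ h\<close> even, while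
        \<open>N\<close> is odd.\<close>
      moreover have "\<not> 2 ^ h dvd N"
        using False unfolding h' by (metis dvd_trans dvd_triv_left power_Suc)
      ultimately show ?thesis by (simp add: h_def)
    qed
  qed
qed simp

section \<open>Averages over the iterates of \<open>twist\<close>\<close>

lemma sum_lessThan_double:
  fixes f :: "nat \<Rightarrow> 'a::comm_monoid_add"
  shows "(\<Sum>k<2 * N. f k) = (\<Sum>k<N. f (2 * k)) + (\<Sum>k<N. f (Suc (2 * k)))"
  by (induction N) (auto simp: ac_simps)

lemma sum_funpow_twist_Node:
  fixes g :: "'a tree \<Rightarrow> 'b::comm_monoid_add"
  shows "(\<Sum>k<2 ^ Suc K. g ((twist ^^ k) (Node l m r))) =
    (\<Sum>k<2 ^ K. g (Node ((twist ^^ k) l) m ((twist ^^ k) r))) +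
    (\<Sum>k<2 ^ K. g (Node ((twist ^^ Suc k) r) m ((twist ^^ k) l)))"
  unfolding power_Suc sum_lessThan_double funpow_twist_even funpow_twist_odd ..

text \<open>The number \<open>2 ^ K\<close> of terms is a multiple of the period, so the shift
  trades the first term for an equal one at the end.\<close>

lemma sum_funpow_twist_shift:
  fixes g :: "'a::linorder tree \<Rightarrow> nat"
  assumes "decreasing t" "height t - 1 \<le> K"
  shows "(\<Sum>k<2 ^ K. g ((twist ^^ Suc k) t)) = (\<Sum>k<2 ^ K. g ((twist ^^ k) t))"
proof -
  have "(twist ^^ (2 ^ K)) t = t"
    using assms by (simp add: funpow_twist_eq_self_iff le_imp_power_dvd)
  then show ?thesis
    using sum.lessThan_Suc_shift[of "\<lambda>k. g ((twist ^^ k) t)" "2 ^ K"]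
    by (simp del: funpow.simps(2))
qed

text \<open>A record in the final position of \<open>u\<close> is followed by the record \<open>m\<close> in \<open>u m v\<close>, and no entry
  of \<open>v\<close> is a record.\<close>

fun tree_rasc :: "'a tree \<Rightarrow> nat" where
  "tree_rasc Leaf = 0"
| "tree_rasc (Node l m r) = tree_rasc l + of_bool (r = Leaf)"

text \<open>With more than one node, each nonempty subtree contributes \<open>2 ^ (K - 1)\<close> by
  induction, \<open>l\<close> in the even and \<open>r\<close> in the odd iterates. An empty subtree
  contributes as much through the root, in those iterates where it stands on the right. The exponent
  \<open>K\<close> may exceed the one of the period because two subtrees of different heights are
  summed over the same range.\<close>

lemma sum_tree_rasc:
  assumes "decreasing t" "height t - 1 \<le> K"
  shows "(\<Sum>k<2 ^ K. tree_rasc ((twist ^^ k) t)) = (if t = Leaf then 0 else 2 ^ K)"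
  using assms
proof (induction t arbitrary: K)
  case (Node l m r)
  show ?case
  proof (cases "l = Leaf \<and> r = Leaf")
    case True
    have "(twist ^^ k) (Node Leaf m Leaf) = Node Leaf m Leaf" for k
      by (induction k) auto
    with True show ?thesis by simp
  next
    case False
    then have "max (height l) (height r) > 0"
      by (cases l; cases r) auto
    \<comment> \<open>A tree with a nonempty subtree has height at least 2, so \<open>K\<close> is
      positive and one factor 2 can be split off.\<close>
    then obtain K' where K: "K = Suc K'" and "height l - 1 \<le> K'" "height r - 1 \<le> K'"
      using Node.prems(2) by (cases K) auto
    then show ?thesis
      using Node.IH Node.prems(1) False
      unfolding K sum_funpow_twist_Node
      by (simp add: sum.distrib sum_funpow_twist_shift del: funpow.simps(2))
  qed
qed simp

text \<open>Precedence in the inorder word, phrased along the recursion of \<open>twist\<close>;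
  \<open>before_iff_nth\<close> expresses it by positions.\<close>

fun before :: "'a \<Rightarrow> 'a \<Rightarrow> 'a tree \<Rightarrow> bool" where
  "before i j Leaf \<longleftrightarrow> False"
| "before i j (Node l m r) \<longleftrightarrow> before i j l \<or> before i j r \<or>
     i \<in> set_tree l \<and> j \<in> insert m (set_tree r) \<or> i = m \<and> j \<in> set_tree r"

lemma before_in_set: "before i j t \<Longrightarrow> i \<in> set_tree t \<and> j \<in> set_tree t"
  by (induction t) auto

text \<open>If \<open>i\<close> and \<open>j\<close> lie in the same subtree, the induction
  hypothesis applies to the even and to the odd iterates. Otherwise their order depends only on the
  sides of the root, which alternate.\<close>

lemma sum_before:
  assumes "decreasing t" "height t - 1 \<le> K" "i \<in> set_tree t" "j \<in> set_tree t" "i \<noteq> j"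
  shows "2 * (\<Sum>k<2 ^ K. of_bool (before i j ((twist ^^ k) t)) :: nat) = 2 ^ K"
  using assms
proof (induction t arbitrary: K)
  case (Node l m r)
  have "max (height l) (height r) > 0"
    using Node.prems by (cases l; cases r) auto
  then obtain K' where K: "K = Suc K'" and le: "height l - 1 \<le> K'" "height r - 1 \<le> K'"
    using Node.prems(2) by (cases K) auto
  have dec: "decreasing l" "decreasing r" "m \<notin> set_tree l" "m \<notin> set_tree r"
    "set_tree l \<inter> set_tree r = {}"
    using Node.prems(1) by auto
  have not_before: "\<not> before i j ((twist ^^ k) s)" if "\<not> (i \<in> set_tree s \<and> j \<in> set_tree s)" for s k
    using before_in_set[of i j "(twist ^^ k) s"] that by auto
  note split = sum_funpow_twist_Node[of "\<lambda>s. of_bool (before i j s) :: nat"]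
  consider (l) "i \<in> set_tree l" "j \<in> set_tree l" | (r) "i \<in> set_tree r" "j \<in> set_tree r"
    | (other) "\<not> (i \<in> set_tree l \<and> j \<in> set_tree l)" "\<not> (i \<in> set_tree r \<and> j \<in> set_tree r)"
    by blast
  then show ?case
  proof cases
    case l
    then have "i \<notin> set_tree r" "j \<notin> set_tree r" "i \<noteq> m" "j \<noteq> m" using dec by auto
    then show ?thesis
      using Node.IH(1)[OF dec(1) le(1) l Node.prems(5)] l not_before[of r]
      unfolding K split by (simp del: funpow.simps(2))
  next
    case r
    then have "i \<notin> set_tree l" "j \<notin> set_tree l" "i \<noteq> m" "j \<noteq> m" using dec by auto
    \<comment> \<open>In the odd iterates the right subtree carries one additional twist, which the
      shift of the sum absorbs.\<close>
    then show ?thesis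
      using Node.IH(2)[OF dec(2) le(2) r Node.prems(5)] r not_before[of l]
        sum_funpow_twist_shift[OF dec(2) le(2), of "\<lambda>s. of_bool (before i j s)"]
      unfolding K split by (simp del: funpow.simps(2) sum_of_bool_eq)
  next
    case other
    \<comment> \<open>With \<open>i\<close> and \<open>j\<close> in different ones of
      \<open>l\<close>, \<open>{m}\<close> and \<open>r\<close>, exactly one of the arrangements
      \<open>l m r\<close> and \<open>r m l\<close> puts \<open>i\<close> first.\<close>
    have "(i \<in> set_tree l \<and> j \<in> insert m (set_tree r) \<or> i = m \<and> j \<in> set_tree r) \<noteq>
        (i \<in> set_tree r \<and> j \<in> insert m (set_tree l) \<or> i = m \<and> j \<in> set_tree l)"
      using Node.prems(3-5) other dec by auto
    then show ?thesis
      using not_before[of l] not_before[of r] other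
      unfolding K split
      by (cases "i \<in> set_tree l \<and> j \<in> insert m (set_tree r) \<or> i = m \<and> j \<in> set_tree r")
        (simp_all del: funpow.simps(2))
  qed
qed simp

section \<open>Heights of heaps\<close>

text \<open>The library's \<open>height\<close> counts the nodes of a longest path. The cases
  separate empty subtrees, whose \<open>leaf_depths\<close> is empty and has no meaningful
  \<open>Max\<close>.\<close>

lemma edge_height_eq: "t \<noteq> Leaf \<Longrightarrow> edge_height t = height t - 1"
proof -
  have fin: "finite (leaf_depths t)" for t :: "'b tree"
    by (induction t) auto
  have ne: "leaf_depths t = {} \<longleftrightarrow> t = Leaf" for t :: "'b tree"
    by (induction t) auto
  assume "t \<noteq> Leaf"
  then have "Max (leaf_depths t) = height t - 1"
  proof (induction t)
    case (Node l m r)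
    have eq: "Max (leaf_depths (Node l m r)) = Suc (Max (leaf_depths l \<union> leaf_depths r))"
      if "\<not> (l = Leaf \<and> r = Leaf)"
      using that fin[of l] fin[of r] ne[of l] ne[of r]
      by (auto simp: mono_Max_commute[of Suc, symmetric] mono_Suc)
    have *: "height s > 0" if "s \<noteq> Leaf" for s :: "'a tree"
      using that by (cases s) auto
    consider "l = Leaf" "r = Leaf" | "l = Leaf" "r \<noteq> Leaf" | "l \<noteq> Leaf" "r = Leaf"
      | "l \<noteq> Leaf" "r \<noteq> Leaf" by blast
    then show ?case
    proof cases
      case 4
      then show ?thesis
        using eq Node.IH *[of l] *[of r] fin[of l] fin[of r] ne[of l] ne[of r]
        by (simp add: Max_Un del: leaf_depths.simps)
    next
      case 1
      then show ?thesis by simp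
    qed (use eq Node.IH * in \<open>auto simp del: leaf_depths.simps(2)\<close>)
  qed simp
  then show ?thesis by (simp add: edge_height_def)
qed

text \<open>Put the maximum at the root and divide the other labels evenly. Such balanced trees
  yield the smallest orbits.\<close>

lemma ex_decreasing_tree:
  fixes A :: "'a::linorder set"
  assumes "finite A" "card A < 2 ^ h"
  shows "\<exists>t. decreasing t \<and> set_tree t = A \<and> height t \<le> h"
  using assms
proof (induction h arbitrary: A)
  case 0
  then show ?case by (intro exI[of _ Leaf]) auto
next
  case (Suc h)
  show ?case
  proof (cases "A = {}")
    case True
    then show ?thesis by (intro exI[of _ Leaf]) auto
  next
    case False
    define B where "B = A - {Max A}"
    have A: "A = insert (Max A) B" and fin: "finite B" "finite A"
      using Max_in[OF Suc.prems(1) False] Suc.prems(1) unfolding B_def by blast+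
    have less: "x < Max A" if "x \<in> B" for x
      using that fin by (simp add: B_def less_le)
    have "card B = card A - 1" "card A > 0"
      using False fin by (auto simp: B_def card_gt_0_iff)
    \<comment> \<open>Without its maximum, \<open>A\<close> has at most \<open>2 ^ Suc h - 2\<close>
      elements, so either half has at most \<open>2 ^ h - 1\<close>.\<close>
    then have "card B div 2 < 2 ^ h" "card B - card B div 2 < 2 ^ h"
      using Suc.prems by auto
    moreover obtain C where "C \<subseteq> B" "card C = card B div 2"
      using obtain_subset_with_card_n[of "card B div 2" B] by auto
    moreover from this have "card (B - C) = card B - card B div 2" "finite C"
      using fin by (auto simp: card_Diff_subset finite_subset)
    ultimately obtain l r where "decreasing l" "set_tree l = C" "height l \<le> h"
        "decreasing r" "set_tree r = B - C" "height r \<le> h"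
      using Suc.IH[of C] Suc.IH[of "B - C"] fin by auto
    then show ?thesis
      using A less \<open>C \<subseteq> B\<close> by (intro exI[of _ "Node l (Max A) r"]) auto
  qed
qed

section \<open>The permutation of a decreasing tree\<close>

text \<open>A cycle read backwards is its inverse. Each cycle rotates its own list by one, and the
  rotations before and after reversal cancel along \<open>rev cs\<close>.\<close>

lemma cycle_of_list_rev_comp:
  assumes "distinct cs"
  shows "cycle_of_list cs \<circ> cycle_of_list (rev cs) = id"
proof -
  let ?c = "cycle_of_list cs" and ?d = "cycle_of_list (rev cs)"
  have "map ?c cs = rotate1 cs" "map ?d (rev cs) = rotate1 (rev cs)"
    using cyclic_rotation[of cs 1] cyclic_rotation[of "rev cs" 1] assms by auto
  moreover have "rotate1 (rev (map ?c cs)) = map ?c (rotate1 (rev cs))"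
    by (simp only: rev_map rotate1_map)
  ultimately have "map (?c \<circ> ?d) (rev cs) = rotate1 (rev (rotate1 cs))"
    by (simp flip: map_map)
  also have "\<dots> = rev cs" by (cases cs) auto
  finally have "map (?c \<circ> ?d) (rev cs) = map id (rev cs)" by simp
  then have "(?c \<circ> ?d) x = x" if "x \<in> set cs" for x
    using that unfolding map_eq_conv by auto
  moreover have "(?c \<circ> ?d) x = x" if "x \<notin> set cs" for x
    using that by (simp add: id_outside_supp)
  ultimately show ?thesis by fastforce
qed

text \<open>Rotating \<open>x # rev xs\<close> by one gives \<open>rev (x # xs)\<close>, so a cycle
  can be inverted while keeping its largest element in front.\<close>

lemma cycle_of_list_Cons_rev_comp:
  assumes "distinct (x # xs)"
  shows "cycle_of_list (x # xs) \<circ> cycle_of_list (x # rev xs) = id"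
proof -
  have "cycle_of_list (x # rev xs) = cycle_of_list (rotate 1 (x # rev xs))"
    by (rule cycle_of_list_rotate_independent) (use assms in simp)
  then show ?thesis
    using cycle_of_list_rev_comp[OF assms] by simp
qed

lemma funpow_cycle_of_list_hd:
  assumes "distinct (x # xs)"
  shows "(cycle_of_list (x # xs) ^^ k) x = (x # xs) ! (k mod length (x # xs))"
proof -
  have "map (cycle_of_list (x # xs) ^^ k) (x # xs) ! 0 = rotate k (x # xs) ! 0"
    using cyclic_rotation[OF assms] by metis
  then show ?thesis by (simp add: nth_rotate)
qed

text \<open>The iterates of the head run through the list in order, and by distinctness they first
  return after \<open>length (x # xs)\<close> steps.\<close>

lemma support_cycle_of_list:
  assumes "distinct (x # xs)"
  shows "support (cycle_of_list (x # xs)) x = x # xs"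
proof -
  let ?c = "cycle_of_list (x # xs)" and ?n = "length (x # xs)"
  have *: "(?c ^^ k) x = x \<longleftrightarrow> ?n dvd k" for k
  proof -
    have "(?c ^^ k) x = x \<longleftrightarrow> (x # xs) ! (k mod ?n) = (x # xs) ! 0"
      unfolding funpow_cycle_of_list_hd[OF assms] by simp
    also have "\<dots> \<longleftrightarrow> ?n dvd k"
      by (subst nth_eq_iff_index_eq[OF assms]) (auto simp: dvd_eq_mod_eq_0)
    finally show ?thesis .
  qed
  have "least_power ?c x = ?n"
    unfolding least_power_def * by (rule Least_equality) (auto dest: dvd_imp_le)
  then have "support ?c x = map (\<lambda>i. (x # xs) ! (i mod ?n)) [0..<?n]"
    by (simp only: funpow_cycle_of_list_hd[OF assms])
  also have "\<dots> = map (\<lambda>i. (x # xs) ! i) [0..<?n]"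
    by (rule map_cong) auto
  also have "\<dots> = x # xs" by (rule map_nth)
  finally show ?thesis .
qed

lemma orbit_cycle_of_list:
  assumes "distinct cs" "y \<in> set cs"
  shows "orbit (cycle_of_list cs) y = set cs"
proof -
  obtain x xs where cs: "cs = x # xs" using assms(2) by (cases cs) auto
  have perm: "permutation (cycle_of_list cs)" by (rule permutation_of_cycle)
  have "orbit (cycle_of_list cs) x = set (support (cycle_of_list cs) x)"
    unfolding support_set[OF perm] orbit_altdef_permutation[OF perm] by auto
  also have "\<dots> = set cs"
    using assms(1) unfolding cs by (subst support_cycle_of_list) auto
  finally have "cyclic_on (cycle_of_list cs) (set cs)"
    using cyclic_on_orbit'[OF perm] by metis
  then show ?thesis using assms(2) by (rule orbit_cyclic_eq3)
qed

text \<open>Invariance of \<open>A\<close> under \<open>f\<close> keeps every iterate where the two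
  maps agree. This computes the cycles of a product of disjoint permutations one factor at a
  time.\<close>

lemma funpow_eq_on:
  assumes "x \<in> A" "f ` A \<subseteq> A" "\<And>y. y \<in> A \<Longrightarrow> g y = f y"
  shows "(g ^^ k) x = (f ^^ k) x"
proof -
  have "(g ^^ k) x = (f ^^ k) x \<and> (f ^^ k) x \<in> A"
    using assms by (induction k) auto
  then show ?thesis ..
qed

lemma support_eq_on:
  assumes "x \<in> A" "f ` A \<subseteq> A" "\<And>y. y \<in> A \<Longrightarrow> g y = f y"
  shows "support g x = support f x"
  using funpow_eq_on[OF assms] by (simp add: least_power_def)

lemma orbit_eq_on:
  assumes "x \<in> A" "f ` A \<subseteq> A" "\<And>y. y \<in> A \<Longrightarrow> g y = f y"
  shows "orbit g x = orbit f x"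
  using funpow_eq_on[OF assms] by (simp add: orbit_altdef)

lemma permutes_disjoint_commute:
  assumes "f permutes A" "g permutes B" "A \<inter> B = {}"
  shows "f \<circ> g = g \<circ> f"
proof
  fix x
  consider "x \<in> A" "x \<notin> B" | "x \<in> B" "x \<notin> A" | "x \<notin> A" "x \<notin> B" using assms(3) by blast
  then show "(f \<circ> g) x = (g \<circ> f) x"
  proof cases
    case 1
    then have "f x \<notin> B" using assms permutes_in_image[OF assms(1)] by blast
    then show ?thesis using 1 assms by (simp add: permutes_not_in)
  next
    case 2
    then have "g x \<notin> A" using assms permutes_in_image[OF assms(2)] by blast
    then show ?thesis using 2 assms by (simp add: permutes_not_in)
  qed (use assms in \<open>simp add: permutes_not_in\<close>)
qed

text \<open>The cycle of the root \<open>m\<close> in the permutation whose Renyi--Foata image is the word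
  \<open>u m v\<close> is \<open>(m v)\<close>, and the remaining cycles are those obtained from \<open>u\<close>.\<close>

fun tree_perm :: "'a tree \<Rightarrow> 'a \<Rightarrow> 'a" where
  "tree_perm Leaf = id"
| "tree_perm (Node l m r) = cycle_of_list (m # inorder r) \<circ> tree_perm l"

text \<open>For a decreasing tree these are the records of the inorder word from left to right,
  hence the first elements of the cycles of \<open>tree_perm\<close>.\<close>

fun left_spine :: "'a tree \<Rightarrow> 'a list" where
  "left_spine Leaf = []"
| "left_spine (Node l m r) = left_spine l @ [m]"

lemma set_left_spine: "set (left_spine t) \<subseteq> set_tree t"
  by (induction t) auto

lemma distinct_inorder: "decreasing t \<Longrightarrow> distinct (inorder t)"
  by (induction t) auto

lemma set_tree_mirror [simp]: "set_tree (mirror t) = set_tree t"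
  by (induction t) auto

lemma decreasing_mirror [simp]: "decreasing (mirror t) = decreasing t"
  by (induction t) auto

lemma tree_perm_permutes:
  assumes "decreasing t"
  shows "tree_perm t permutes set_tree t"
  using assms
proof (induction t)
  case (Node l m r)
  have "cycle_of_list (m # inorder r) permutes set_tree (Node l m r)"
    by (rule permutes_subset[OF cycle_permutes]) auto
  moreover have "tree_perm l permutes set_tree (Node l m r)"
    by (rule permutes_subset[OF Node.IH(1)]) (use Node.prems in auto)
  ultimately show ?case unfolding tree_perm.simps by (intro permutes_compose)
qed (simp add: permutes_id)

context
  fixes l r :: "'a::linorder tree" and m :: 'a
  assumes dec: "decreasing (Node l m r)"
begin

text \<open>The two factors of \<open>tree_perm (Node l m r)\<close> have disjoint supports, so on
  the labels of \<open>l\<close>, and likewise on \<open>m\<close> and the labels of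
  \<open>r\<close>, only one of them acts.\<close>

lemma tree_perm_Node_left: "x \<in> set_tree l \<Longrightarrow> tree_perm (Node l m r) x = tree_perm l x"
  using dec permutes_in_image[OF tree_perm_permutes[of l], of x]
  by (auto intro!: id_outside_supp)

lemma tree_perm_Node_right:
  "x \<in> set (m # inorder r) \<Longrightarrow> tree_perm (Node l m r) x = cycle_of_list (m # inorder r) x"
  using dec permutes_not_in[OF tree_perm_permutes[of l], of x] by (cases "x \<in> set_tree l") auto

lemma tree_perm_image: "tree_perm l ` set_tree l \<subseteq> set_tree l"
  using dec permutes_image[OF tree_perm_permutes[of l]] by simp

lemma cycle_of_list_image:
  "cycle_of_list (m # inorder r) ` set (m # inorder r) \<subseteq> set (m # inorder r)"
  by (simp only: permutes_image[OF cycle_permutes])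

lemma distinct_Cons_inorder: "distinct (m # inorder r)"
  using dec by (auto simp: distinct_inorder)

lemma orbit_tree_perm_Node_left:
  "x \<in> set_tree l \<Longrightarrow> orbit (tree_perm (Node l m r)) x = orbit (tree_perm l) x"
  by (rule orbit_eq_on[OF _ tree_perm_image tree_perm_Node_left])

lemma orbit_tree_perm_Node_right:
  assumes "x \<in> insert m (set_tree r)"
  shows "orbit (tree_perm (Node l m r)) x = insert m (set_tree r)"
proof -
  have x: "x \<in> set (m # inorder r)" using assms by simp
  have "orbit (tree_perm (Node l m r)) x = orbit (cycle_of_list (m # inorder r)) x"
    by (rule orbit_eq_on[OF x cycle_of_list_image tree_perm_Node_right])
  also have "\<dots> = insert m (set_tree r)"
    using orbit_cycle_of_list[OF distinct_Cons_inorder x] by simp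
  finally show ?thesis .
qed

lemma support_tree_perm_Node_left:
  "x \<in> set_tree l \<Longrightarrow> support (tree_perm (Node l m r)) x = support (tree_perm l) x"
  by (rule support_eq_on[OF _ tree_perm_image tree_perm_Node_left])

lemma support_tree_perm_root: "support (tree_perm (Node l m r)) m = m # inorder r"
proof -
  have "m \<in> set (m # inorder r)" by simp
  from support_eq_on[OF this cycle_of_list_image tree_perm_Node_right]
  show ?thesis using support_cycle_of_list[OF distinct_Cons_inorder] by metis
qed

end

section \<open>The canonical cycle decomposition of \<open>tree_perm\<close>\<close>

lemma sorted_wrt_left_spine: "decreasing t \<Longrightarrow> sorted_wrt (<) (left_spine t)"
  using set_left_spine by (induction t) (fastforce simp: sorted_wrt_append)+

text \<open>The cycle through the root consists of \<open>m\<close> and the labels of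
  \<open>r\<close>, with maximum \<open>m\<close>; the other cycles are those of
  \<open>tree_perm l\<close>.\<close>

lemma set_left_spine_eq:
  assumes "decreasing t"
  shows "set (left_spine t) = {x \<in> set_tree t. x = Max (orbit (tree_perm t) x)}"
  using assms
proof (induction t)
  case (Node l m r)
  have "Max (insert m (set_tree r)) = m"
    by (rule Max_eqI) (use Node.prems in \<open>auto simp: less_imp_le\<close>)
  then have "{x \<in> insert m (set_tree r). x = Max (orbit (tree_perm (Node l m r)) x)} = {m}"
    using orbit_tree_perm_Node_right[OF Node.prems] by (auto simp del: tree_perm.simps)
  moreover have "{x \<in> set_tree l. x = Max (orbit (tree_perm (Node l m r)) x)} = set (left_spine l)"
    using orbit_tree_perm_Node_left[OF Node.prems] Node by (auto simp del: tree_perm.simps)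
  moreover have "set_tree (Node l m r) = insert m (set_tree r) \<union> set_tree l" by auto
  ultimately show ?case by (auto simp del: tree_perm.simps)
qed simp

lemma concat_support_left_spine:
  assumes "decreasing t"
  shows "concat (map (support (tree_perm t)) (left_spine t)) = inorder t"
  using assms
proof (induction t)
  case (Node l m r)
  have "map (support (tree_perm (Node l m r))) (left_spine l) =
      map (support (tree_perm l)) (left_spine l)"
    by (rule map_cong[OF refl], rule support_tree_perm_Node_left[OF Node.prems])
      (use set_left_spine[of l] in blast)
  moreover have "concat (map (support (tree_perm l)) (left_spine l)) = inorder l"
    using Node by simp
  ultimately show ?case
    using support_tree_perm_root[OF Node.prems]
    by (simp only: left_spine.simps inorder.simps map_append concat_append list.map concat.simps append_Nil2 append.simps)
qed simp

text \<open>The left spine is increasing, so it lists the cycle maxima in the order that the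
  canonical decomposition prescribes.\<close>

lemma concat_ccd_tree_perm:
  assumes "decreasing t" "set_tree t = {1..n}"
  shows "concat (ccd n (tree_perm t)) = inorder t"
proof -
  have "sorted_list_of_set (set (left_spine t)) = left_spine t"
    using sorted_wrt_left_spine[OF assms(1)]
    by (intro sorted_list_of_set.idem_if_sorted_distinct) (auto simp: strict_sorted_iff)
  then show ?thesis
    using concat_support_left_spine[OF assms(1)] set_left_spine_eq[OF assms(1)] assms(2)
    by (simp add: ccd_def)
qed

section \<open>Reversal and inversion on trees\<close>

text \<open>This is the origin of \<open>twist\<close>: mirroring reverses the word, and inverting
  the resulting permutation amounts to twisting the original tree.\<close>

lemma tree_perm_twist_mirror:
  assumes "decreasing t"
  shows "tree_perm (twist t) \<circ> tree_perm (mirror t) = id"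
  using assms
proof (induction t)
  case (Node l m r)
  let ?c = "cycle_of_list (m # inorder l)" and ?d = "cycle_of_list (m # rev (inorder l))"
  \<comment> \<open>One factor moves only labels of \<open>r\<close>, the other only
    \<open>m\<close> and labels of \<open>l\<close>. Commuting them brings each factor next to its
    inverse.\<close>
  have "tree_perm (twist r) \<circ> ?d = ?d \<circ> tree_perm (twist r)"
    by (rule permutes_disjoint_commute[OF tree_perm_permutes cycle_permutes]) (use Node.prems in auto)
  moreover have "?c \<circ> ?d = id"
    by (rule cycle_of_list_Cons_rev_comp) (use Node.prems in \<open>auto simp: distinct_inorder\<close>)
  moreover have "tree_perm (twist r) \<circ> tree_perm (mirror r) = id"
    by (rule Node.IH(2)) (use Node.prems in simp)
  ultimately have "?c \<circ> (tree_perm (twist r) \<circ> (?d \<circ> tree_perm (mirror r))) = id"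
    by (simp only: flip: comp_assoc) (simp only: comp_assoc comp_id id_comp)
  then show ?case by (simp only: twist.simps mirror.simps tree_perm.simps inorder_mirror comp_assoc)
qed simp

lemma inv_tree_perm_mirror:
  assumes "decreasing t"
  shows "inv (tree_perm (mirror t)) = tree_perm (twist t)"
proof -
  have "tree_perm (mirror t) \<circ> inv (tree_perm (mirror t)) = id"
    by (rule permutes_inv_o(1)[OF tree_perm_permutes]) (use assms in simp)
  from left_right_inverse_eq[OF tree_perm_twist_mirror[OF assms] this] show ?thesis ..
qed

text \<open>The root is fixed exactly if its cycle is \<open>{m}\<close>, that is, if
  \<open>r\<close> is empty; labels of \<open>r\<close> share a cycle with \<open>m\<close> and are
  never fixed.\<close>

lemma tree_rasc_eq_card_fixed:
  assumes "decreasing t"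
  shows "tree_rasc t = card {i \<in> set_tree t. tree_perm t i = i}"
  using assms
proof (induction t)
  case (Node l m r)
  let ?w = "tree_perm (Node l m r)"
  have "?w i = i \<longleftrightarrow> r = Leaf \<and> i = m" if "i \<in> insert m (set_tree r)" for i
  proof -
    have "?w i = i \<longleftrightarrow> insert m (set_tree r) = {i}"
      using orbit_eq_singleton_iff[of ?w i] orbit_tree_perm_Node_right[OF Node.prems that] by simp
    then show ?thesis using Node.prems by (cases r) auto
  qed
  then have "{i \<in> insert m (set_tree r). ?w i = i} = (if r = Leaf then {m} else {})"
    by (auto simp del: tree_perm.simps)
  moreover have "{i \<in> set_tree l. ?w i = i} = {i \<in> set_tree l. tree_perm l i = i}"
    using tree_perm_Node_left[OF Node.prems] by (auto simp del: tree_perm.simps)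
  moreover have "{i \<in> set_tree (Node l m r). ?w i = i} =
      {i \<in> set_tree l. ?w i = i} \<union> {i \<in> insert m (set_tree r). ?w i = i}" by auto
  ultimately have "card {i \<in> set_tree (Node l m r). ?w i = i} =
      card ({i \<in> set_tree l. tree_perm l i = i} \<union> (if r = Leaf then {m} else {}))" by simp
  also have "\<dots> = card {i \<in> set_tree l. tree_perm l i = i} + of_bool (r = Leaf)"
    using Node.prems by (subst card_Un_disjoint) auto
  finally show ?case using Node by simp
qed simp

lemma root_in_orbit_tree_perm_iff:
  assumes "decreasing (Node l m r)" "i \<in> set_tree (Node l m r)"
  shows "m \<in> orbit (tree_perm (Node l m r)) i \<longleftrightarrow> i \<in> insert m (set_tree r)"
proof (cases "i \<in> insert m (set_tree r)")
  case True
  then show ?thesis using orbit_tree_perm_Node_right[OF assms(1)] by blast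
next
  case False
  then have "i \<in> set_tree l" using assms(2) by auto
  then have "orbit (tree_perm (Node l m r)) i \<subseteq> set_tree l"
    using orbit_tree_perm_Node_left[OF assms(1)] assms(1)
      permutes_orbit_subset[OF tree_perm_permutes[of l]] by simp
  then show ?thesis using False assms(1) by auto
qed

section \<open>Words and decreasing trees\<close>

lemma heap_of_append_Cons:
  assumes "\<forall>x\<in>set us \<union> set vs. x < m"
  shows "heap_of (us @ m # vs) = Node (heap_of us) m (heap_of vs)"
proof -
  have Max: "Max (set (us @ m # vs)) = m"
    by (rule Max_eqI) (use assms in \<open>auto simp: less_imp_le\<close>)
  have ne: "\<forall>x\<in>set us. x \<noteq> m" using assms by auto
  \<comment> \<open>The recursive equation of \<open>heap_of\<close> is stated for a
    \<open>Cons\<close> pattern, so the word is put in that form and folded back afterwards.\<close>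
  obtain y ys where y: "us @ m # vs = y # ys" by (cases us) auto
  show ?thesis
    unfolding y heap_of.simps
    unfolding y[symmetric] Max Let_def
    using ne by (simp add: takeWhile_append2 dropWhile_append2)
qed

lemma heap_of_inorder: "decreasing t \<Longrightarrow> heap_of (inorder t) = t"
  by (induction t) (auto simp: heap_of_append_Cons)

lemma heap_of_distinct:
  assumes "distinct xs"
  shows "decreasing (heap_of xs) \<and> inorder (heap_of xs) = xs"
  using assms
proof (induction xs rule: length_induct)
  case (1 xs)
  show ?case
  proof (cases "xs = []")
    case False
    then have "Max (set xs) \<in> set xs" by simp
    then obtain us vs where xs: "xs = us @ Max (set xs) # vs" by (meson split_list)
    define m where "m = Max (set xs)"
    have xs': "xs = us @ m # vs" using xs m_def by simp
    have le: "x \<le> m" if "x \<in> set xs" for x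
      using that by (simp add: m_def)
    have less: "\<forall>x\<in>set us \<union> set vs. x < m"
      using le "1.prems" unfolding xs' by (fastforce simp: less_le)
    have *: "decreasing (heap_of us)" "inorder (heap_of us) = us"
        "decreasing (heap_of vs)" "inorder (heap_of vs) = vs"
      using 1 unfolding xs' by auto
    then have "set_tree (heap_of us) = set us" "set_tree (heap_of vs) = set vs"
      by (metis set_inorder)+
    then show ?thesis
      using * less "1.prems" unfolding xs' by (auto simp: heap_of_append_Cons)
  qed simp
qed

lemma one_line_of_one_line [simp]: "length xs = n \<Longrightarrow> one_line n (of_one_line xs) = xs"
  by (auto simp: one_line_def of_one_line_def nth_upt intro!: nth_equalityI simp del: upt_Suc)

lemma of_one_line_one_line: "w \<in> Sym n \<Longrightarrow> of_one_line (one_line n w) = w"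
  by (auto simp: one_line_def of_one_line_def Sym_def permutes_def fun_eq_iff nth_upt simp del: upt_Suc)

lemma set_one_line: "w \<in> Sym n \<Longrightarrow> set (one_line n w) = {1..n}"
  using permutes_image[of w "{1..n}"]
  by (simp add: one_line_def Sym_def atLeastLessThanSuc_atLeastAtMost del: upt_Suc)

lemma distinct_one_line: "w \<in> Sym n \<Longrightarrow> distinct (one_line n w)"
  using permutes_inj_on[of w "{1..n}"]
  by (simp add: one_line_def Sym_def distinct_map atLeastLessThanSuc_atLeastAtMost del: upt_Suc)

lemma of_one_line_in_Sym:
  assumes "distinct xs" "set xs = {1..n}"
  shows "of_one_line xs \<in> Sym n"
proof -
  have len: "length xs = n" using distinct_card[OF assms(1)] assms(2) by simp
  have "set (one_line n (of_one_line xs)) = of_one_line xs ` {1..n}"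
    by (simp add: one_line_def atLeastLessThanSuc_atLeastAtMost del: upt_Suc)
  then have "of_one_line xs ` {1..n} = {1..n}"
    using len assms by simp
  then have "bij_betw (of_one_line xs) {1..n} {1..n}"
    by (simp add: bij_betw_def eq_card_imp_inj_on)
  then show ?thesis
    unfolding Sym_def using len
    by (auto intro!: bij_imp_permutes simp: of_one_line_def)
qed

lemma finite_Sym: "finite (Sym n)"
  by (simp add: Sym_def finite_permutations)

section \<open>Decreasing trees in bijection with permutations\<close>

definition decreasing_trees :: "nat \<Rightarrow> nat tree set" where
  "decreasing_trees n = {t. decreasing t \<and> set_tree t = {1..n}}"

definition word_tree :: "nat \<Rightarrow> (nat \<Rightarrow> nat) \<Rightarrow> nat tree" where
  "word_tree n w = heap_of (one_line n w)"

definition tree_word :: "nat tree \<Rightarrow> nat \<Rightarrow> nat" where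
  "tree_word t = of_one_line (inorder t)"

lemma length_inorder_decreasing: "t \<in> decreasing_trees n \<Longrightarrow> length (inorder t) = n"
  unfolding decreasing_trees_def
  by (metis (mono_tags) card_atLeastAtMost diff_Suc_1 distinct_card distinct_inorder mem_Collect_eq set_inorder)

lemma word_tree_in: "w \<in> Sym n \<Longrightarrow> word_tree n w \<in> decreasing_trees n"
  using heap_of_distinct[OF distinct_one_line] set_one_line
  unfolding decreasing_trees_def word_tree_def by (metis (mono_tags, lifting) mem_Collect_eq set_inorder)

lemma tree_word_in: "t \<in> decreasing_trees n \<Longrightarrow> tree_word t \<in> Sym n"
  by (simp add: decreasing_trees_def tree_word_def of_one_line_in_Sym distinct_inorder)

lemma tree_word_word_tree: "w \<in> Sym n \<Longrightarrow> tree_word (word_tree n w) = w"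
  by (simp add: tree_word_def word_tree_def heap_of_distinct distinct_one_line of_one_line_one_line)

lemma word_tree_tree_word: "t \<in> decreasing_trees n \<Longrightarrow> word_tree n (tree_word t) = t"
  using length_inorder_decreasing
  by (simp add: tree_word_def word_tree_def heap_of_inorder decreasing_trees_def)

lemma inj_on_word_tree: "inj_on (word_tree n) (Sym n)"
  by (rule inj_on_inverseI[of _ tree_word]) (rule tree_word_word_tree)

lemma decreasing_trees_closed:
  assumes "t \<in> decreasing_trees n"
  shows "twist t \<in> decreasing_trees n" "mirror t \<in> decreasing_trees n"
  using assms by (simp_all add: decreasing_trees_def)

lemma tree_perm_in_Sym: "t \<in> decreasing_trees n \<Longrightarrow> tree_perm t \<in> Sym n"
  using tree_perm_permutes[of t] by (simp add: decreasing_trees_def Sym_def)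

lemma renyi_foata_tree_perm: "t \<in> decreasing_trees n \<Longrightarrow> renyi_foata n (tree_perm t) = tree_word t"
  by (simp add: renyi_foata_def tree_word_def decreasing_trees_def concat_ccd_tree_perm)

lemma renyi_foata_tree_perm_word_tree:
  "u \<in> Sym n \<Longrightarrow> renyi_foata n (tree_perm (word_tree n u)) = u"
  by (simp add: renyi_foata_tree_perm word_tree_in tree_word_word_tree)

text \<open>Having \<open>renyi_foata n\<close> as a left inverse makes the map injective, and
  \<open>Sym n\<close> is finite. Its surjectivity then shows that \<open>renyi_foata n\<close> is
  bijective.\<close>

lemma bij_betw_tree_perm_word_tree: "bij_betw (\<lambda>u. tree_perm (word_tree n u)) (Sym n) (Sym n)"
proof -
  have "inj_on (\<lambda>u. tree_perm (word_tree n u)) (Sym n)"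
    by (rule inj_on_inverseI[of _ "renyi_foata n"]) (rule renyi_foata_tree_perm_word_tree)
  moreover have "(\<lambda>u. tree_perm (word_tree n u)) ` Sym n \<subseteq> Sym n"
    by (auto intro: tree_perm_in_Sym word_tree_in)
  ultimately show ?thesis
    by (simp add: bij_betw_def endo_inj_surj finite_Sym)
qed

lemma bij_betw_renyi_foata: "bij_betw (renyi_foata n) (Sym n) (Sym n)"
proof (rule bij_betw_byWitness[where f' = "\<lambda>u. tree_perm (word_tree n u)"])
  have surj: "\<exists>u\<in>Sym n. w = tree_perm (word_tree n u)" if "w \<in> Sym n" for w
    using that bij_betw_imp_surj_on[OF bij_betw_tree_perm_word_tree] by blast
  show "\<forall>w\<in>Sym n. tree_perm (word_tree n (renyi_foata n w)) = w"
    using surj renyi_foata_tree_perm_word_tree by metis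
  show "renyi_foata n ` Sym n \<subseteq> Sym n"
    using surj renyi_foata_tree_perm_word_tree by (metis image_subsetI)
qed (auto intro: tree_perm_in_Sym word_tree_in simp: renyi_foata_tree_perm_word_tree)

lemma renyi_foata_in: "w \<in> Sym n \<Longrightarrow> renyi_foata n w \<in> Sym n"
  using bij_betw_renyi_foata bij_betwE by blast

lemma renyi_foata_inv_eq:
  assumes "u \<in> Sym n"
  shows "renyi_foata_inv n u = tree_perm (word_tree n u)"
  unfolding renyi_foata_inv_def
  by (rule inv_into_f_eq[OF bij_betw_imp_inj_on[OF bij_betw_renyi_foata]])
    (use assms in \<open>auto intro: tree_perm_in_Sym word_tree_in simp: renyi_foata_tree_perm_word_tree\<close>)

lemma renyi_foata_inv_renyi_foata: "w \<in> Sym n \<Longrightarrow> renyi_foata_inv n (renyi_foata n w) = w"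
  unfolding renyi_foata_inv_def
  by (rule inv_into_f_f[OF bij_betw_imp_inj_on[OF bij_betw_renyi_foata]])

lemma tree_perm_word_tree_renyi_foata:
  "w \<in> Sym n \<Longrightarrow> tree_perm (word_tree n (renyi_foata n w)) = w"
  using renyi_foata_inv_renyi_foata renyi_foata_inv_eq renyi_foata_in by metis

lemma one_line_reversal: "one_line n (reversal n u) = rev (one_line n u)"
  by (rule nth_equalityI)
    (auto simp: one_line_def reversal_def rev_nth nth_upt Suc_diff_Suc simp del: upt_Suc intro!: arg_cong[of _ _ u])

lemma reversal_eq: "u \<in> Sym n \<Longrightarrow> reversal n u = tree_word (mirror (word_tree n u))"
proof -
  assume u: "u \<in> Sym n"
  have "inorder (mirror (word_tree n u)) = one_line n (reversal n u)"
    using heap_of_distinct[OF distinct_one_line[OF u]]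
    by (simp add: inorder_mirror one_line_reversal word_tree_def)
  moreover have "of_one_line (one_line n (reversal n u)) = reversal n u"
    by (auto simp: one_line_def of_one_line_def reversal_def fun_eq_iff nth_upt simp del: upt_Suc)
  ultimately show ?thesis by (simp add: tree_word_def)
qed

text \<open>The composite common to both actions: \<open>phi\<close> applies
  \<open>renyi_foata n\<close> after it, \<open>phi_bar\<close> before it.\<close>

lemma inv_renyi_foata_inv_reversal:
  assumes "u \<in> Sym n"
  shows "inv (renyi_foata_inv n (reversal n u)) = tree_perm (twist (word_tree n u))"
proof -
  define t where "t = word_tree n u"
  have t: "t \<in> decreasing_trees n" using word_tree_in[OF assms] by (simp add: t_def)
  have "renyi_foata_inv n (reversal n u) = tree_perm (mirror t)"
    using decreasing_trees_closed(2)[OF t] assms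
    by (simp add: reversal_eq renyi_foata_inv_eq tree_word_in word_tree_tree_word t_def)
  then show ?thesis
    using t by (simp add: inv_tree_perm_mirror decreasing_trees_def t_def)
qed

lemma phi_eq: "u \<in> Sym n \<Longrightarrow> phi n u = tree_word (twist (word_tree n u))"
  by (simp add: phi_def inv_renyi_foata_inv_reversal renyi_foata_tree_perm word_tree_in
      decreasing_trees_closed)

lemma phi_bar_eq: "w \<in> Sym n \<Longrightarrow> phi_bar n w = tree_perm (twist (word_tree n (renyi_foata n w)))"
  by (simp add: phi_bar_def inv_renyi_foata_inv_reversal renyi_foata_in)

lemma word_tree_phi: "u \<in> Sym n \<Longrightarrow> word_tree n (phi n u) = twist (word_tree n u)"
  by (simp add: phi_eq word_tree_in decreasing_trees_closed word_tree_tree_word)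

lemma phi_in: "u \<in> Sym n \<Longrightarrow> phi n u \<in> Sym n"
  by (simp add: phi_eq word_tree_in decreasing_trees_closed tree_word_in)

lemma renyi_foata_phi_bar: "w \<in> Sym n \<Longrightarrow> renyi_foata n (phi_bar n w) = phi n (renyi_foata n w)"
  by (simp add: phi_bar_eq phi_eq renyi_foata_in word_tree_in decreasing_trees_closed renyi_foata_tree_perm)

lemma phi_bar_in: "w \<in> Sym n \<Longrightarrow> phi_bar n w \<in> Sym n"
  by (simp add: phi_bar_eq renyi_foata_in word_tree_in decreasing_trees_closed tree_perm_in_Sym)

section \<open>Orbits and statistics\<close>

lemma orbit_period:
  assumes "p > 0" and period: "\<And>k. (f ^^ k) x = x \<longleftrightarrow> p dvd k"
  shows "bij_betw (\<lambda>k. (f ^^ k) x) {..<p} (orbit f x)"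
proof (rule bij_betwI')
  fix i j
  assume ij: "i \<in> {..<p}" "j \<in> {..<p}"
  show "(f ^^ i) x = (f ^^ j) x \<longleftrightarrow> i = j"
  proof
    assume eq: "(f ^^ i) x = (f ^^ j) x"
    \<comment> \<open>Advancing both iterates by \<open>p - i\<close> returns the first to
      \<open>x\<close>, so \<open>p\<close> divides \<open>p - i + j\<close>. This number lies
      strictly between 0 and \<open>2 * p\<close>, hence equals \<open>p\<close>.\<close>
    define l where "l = p - i"
    have "l + i = p" using ij by (simp add: l_def)
    then have "(f ^^ (l + i)) x = x" using period by simp
    then have "(f ^^ (l + j)) x = x"
      using eq by (simp add: funpow_add)
    then have "p dvd l + j" using period by blast
    then obtain q where q: "l + j = p * q" ..
    have "0 < l + j" "l + j < p * 2" using ij by (auto simp: l_def)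
    then have "q = 1" using q by (cases q) auto
    then have "l + j = p" using q by simp
    then show "i = j" using \<open>l + i = p\<close> by simp
  qed simp
next
  fix i assume "i \<in> {..<p}"
  \<comment> \<open>An orbit consists of positive iterates; periodicity makes the iterate 0 one of
    them.\<close>
  have "(f ^^ p) x = x" using period by simp
  then show "(f ^^ i) x \<in> orbit f x"
    using \<open>i \<in> {..<p}\<close> assms(1) by (auto simp: orbit_altdef_bounded)
next
  fix y assume "y \<in> orbit f x"
  moreover have "(f ^^ p) x = x" using period by simp
  ultimately show "\<exists>i\<in>{..<p}. y = (f ^^ i) x"
    using assms(1) by (auto simp: orbit_altdef_bounded)
qed

text \<open>Covers \<open>phi\<close> and \<open>phi_bar\<close> at once. As \<open>h\<close> is
  injective, periods under \<open>\<tau>\<close> are periods of trees under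
  \<open>twist\<close>.\<close>

locale twist_conjugate =
  fixes n :: nat and \<tau> :: "'a \<Rightarrow> 'a" and S :: "'a set" and h :: "'a \<Rightarrow> nat tree"
  assumes finite: "finite S"
    and closed: "x \<in> S \<Longrightarrow> \<tau> x \<in> S"
    and inj: "inj_on h S"
    and h_in: "x \<in> S \<Longrightarrow> h x \<in> decreasing_trees n"
    and h_twist: "x \<in> S \<Longrightarrow> h (\<tau> x) = twist (h x)"
begin

lemma bij: "bij_betw \<tau> S S"
proof -
  have "inj_on \<tau> S"
  proof (rule inj_onI)
    fix x y assume xy: "x \<in> S" "y \<in> S" "\<tau> x = \<tau> y"
    then have "twist (h x) = twist (h y)" by (simp flip: h_twist)
    then have "h x = h y" by (rule injD[OF inj_twist])
    then show "x = y" using inj xy by (simp add: inj_on_eq_iff)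
  qed
  moreover have "\<tau> ` S \<subseteq> S" using closed by auto
  ultimately show ?thesis by (simp add: bij_betw_def endo_inj_surj finite)
qed

lemma funpow: "x \<in> S \<Longrightarrow> (\<tau> ^^ k) x \<in> S \<and> h ((\<tau> ^^ k) x) = (twist ^^ k) (h x)"
  by (induction k) (auto simp: closed h_twist)

lemma orbit_bij:
  assumes "x \<in> S"
  shows "bij_betw (\<lambda>k. (\<tau> ^^ k) x) {..<2 ^ (height (h x) - 1)} (orbit \<tau> x)"
proof (rule orbit_period)
  fix k
  have "(\<tau> ^^ k) x = x \<longleftrightarrow> (twist ^^ k) (h x) = h x"
    using funpow[OF assms] inj_on_eq_iff[OF inj _ assms] by metis
  then show "(\<tau> ^^ k) x = x \<longleftrightarrow> 2 ^ (height (h x) - 1) dvd k"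
    using h_in[OF assms] by (simp add: funpow_twist_eq_self_iff decreasing_trees_def)
qed simp

lemma card_orbit: "x \<in> S \<Longrightarrow> card (orbit \<tau> x) = 2 ^ (height (h x) - 1)"
  using bij_betw_same_card[OF orbit_bij] by simp

lemma mesicI:
  assumes f: "\<And>x. x \<in> S \<Longrightarrow> f x = of_nat (g (h x))"
    and sum: "\<And>t. t \<in> decreasing_trees n \<Longrightarrow>
      of_nat (\<Sum>k<2 ^ (height t - 1). g ((twist ^^ k) t)) = c * 2 ^ (height t - 1)"
  shows "mesic c \<tau> S f"
  unfolding mesic_def
proof (intro conjI ballI finite bij)
  fix x assume x: "x \<in> S"
  let ?N = "2 ^ (height (h x) - 1)"
  have "(\<Sum>y\<in>orbit \<tau> x. f y) = (\<Sum>k<?N. f ((\<tau> ^^ k) x))"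
    by (rule sum.reindex_bij_betw[OF orbit_bij[OF x], symmetric])
  also have "\<dots> = of_nat (\<Sum>k<?N. g ((twist ^^ k) (h x)))"
    using funpow[OF x] by (simp add: f)
  also have "\<dots> = c * ?N"
    by (rule sum) (rule h_in[OF x])
  finally show "(\<Sum>y\<in>orbit \<tau> x. f y) / of_nat (card (orbit \<tau> x)) = c"
    using card_orbit[OF x] by simp
qed

end

text \<open>The form required by \<open>mesicI\<close>; \<open>n \<ge> 1\<close> excludes the empty
  tree, whose sum is 0.\<close>

lemma sum_tree_rasc_rat:
  assumes "t \<in> decreasing_trees n" "n \<ge> 1"
  shows "of_nat (\<Sum>k<2 ^ (height t - 1). tree_rasc ((twist ^^ k) t)) = (1::rat) * 2 ^ (height t - 1)"
proof -
  have "t \<noteq> Leaf" using assms by (auto simp: decreasing_trees_def)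
  then show ?thesis
    using sum_tree_rasc[of t "height t - 1"] assms by (simp add: decreasing_trees_def)
qed

lemma sum_before_rat:
  assumes "t \<in> decreasing_trees n" "i \<in> {1..n}" "j \<in> {1..n}" "i \<noteq> j"
  shows "of_nat (\<Sum>k<2 ^ (height t - 1). of_bool (before i j ((twist ^^ k) t))) =
    (1 / 2 :: rat) * 2 ^ (height t - 1)"
proof -
  have "of_nat (2 * (\<Sum>k<2 ^ (height t - 1). of_bool (before i j ((twist ^^ k) t)))) =
      (of_nat (2 ^ (height t - 1)) :: rat)"
    using assms by (subst sum_before) (auto simp: decreasing_trees_def)
  then show ?thesis by (simp add: field_simps)
qed

section \<open>Statistics of permutations as statistics of trees\<close>

lemma left_of_iff:
  assumes "length xs = n"
  shows "left_of n i j (of_one_line xs) \<longleftrightarrow> (\<exists>p q. p < q \<and> q < n \<and> xs ! p = i \<and> xs ! q = j)"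
    (is "?L \<longleftrightarrow> ?R")
proof
  assume ?L
  then obtain p q where "1 \<le> p" "p < q" "q \<le> n" "of_one_line xs p = i" "of_one_line xs q = j"
    by (auto simp: left_of_def)
  then show ?R
    using assms by (intro exI[of _ "p - 1"] exI[of _ "q - 1"]) (auto simp: of_one_line_def)
next
  assume ?R
  then obtain p q where "p < q" "q < n" "xs ! p = i" "xs ! q = j" by blast
  then show ?L
    unfolding left_of_def
    using assms by (intro exI[of _ "Suc p"] exI[of _ "Suc q"]) (auto simp: of_one_line_def)
qed

lemma ex_nth_less_append:
  "(\<exists>p q. p < q \<and> q < length (us @ vs) \<and> (us @ vs) ! p = i \<and> (us @ vs) ! q = j) \<longleftrightarrow>
    (\<exists>p q. p < q \<and> q < length us \<and> us ! p = i \<and> us ! q = j) \<or>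
    (\<exists>p q. p < q \<and> q < length vs \<and> vs ! p = i \<and> vs ! q = j) \<or> i \<in> set us \<and> j \<in> set vs"
  (is "?L \<longleftrightarrow> ?U \<or> ?V \<or> ?UV")
proof
  assume ?L
  then obtain p q where pq: "p < q" "q < length (us @ vs)" "(us @ vs) ! p = i" "(us @ vs) ! q = j"
    by blast
  consider "q < length us" | "p < length us" "length us \<le> q" | "length us \<le> p" by linarith
  then show "?U \<or> ?V \<or> ?UV"
  proof cases
    case 1
    then show ?thesis using pq by (auto simp: nth_append)
  next
    case 2
    then have "i \<in> set us" "j \<in> set vs" using pq by (auto simp: nth_append)
    then show ?thesis by blast
  next
    case 3
    then have "p - length us < q - length us \<and> q - length us < length vs \<and>
        vs ! (p - length us) = i \<and> vs ! (q - length us) = j"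
      using pq by (auto simp: nth_append)
    then show ?thesis by blast
  qed
next
  assume "?U \<or> ?V \<or> ?UV"
  then show ?L
  proof (elim disjE exE conjE)
    fix p q assume "p < q" "q < length us" "us ! p = i" "us ! q = j"
    then show ?L by (intro exI[of _ p] exI[of _ q]) (auto simp: nth_append)
  next
    fix p q assume "p < q" "q < length vs" "vs ! p = i" "vs ! q = j"
    then show ?L
      by (intro exI[of _ "length us + p"] exI[of _ "length us + q"]) (auto simp: nth_append)
  next
    assume "i \<in> set us" "j \<in> set vs"
    then obtain p q where "p < length us" "us ! p = i" "q < length vs" "vs ! q = j"
      by (auto simp: in_set_conv_nth)
    then show ?L
      by (intro exI[of _ p] exI[of _ "length us + q"]) (auto simp: nth_append)
  qed
qed

lemma before_iff_nth:
  "before i j t \<longleftrightarrow>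
    (\<exists>p q. p < q \<and> q < length (inorder t) \<and> inorder t ! p = i \<and> inorder t ! q = j)"
proof (induction t)
  case (Node l m r)
  have "(\<exists>p q. p < q \<and> q < length [m] \<and> [m] ! p = i \<and> [m] ! q = j) = False" by auto
  then show ?case
    using Node ex_nth_less_append[of "inorder l" "[m] @ inorder r" i j]
      ex_nth_less_append[of "[m]" "inorder r" i j]
    by auto
qed simp

lemma left_of_iff_before:
  assumes "u \<in> Sym n"
  shows "left_of n i j u \<longleftrightarrow> before i j (word_tree n u)"
proof -
  let ?t = "word_tree n u"
  have "left_of n i j (of_one_line (inorder ?t)) \<longleftrightarrow> before i j ?t"
    using left_of_iff[OF length_inorder_decreasing[OF word_tree_in[OF assms]], of i j]
      length_inorder_decreasing[OF word_tree_in[OF assms]]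
    by (simp only: before_iff_nth)
  then show ?thesis using tree_word_word_tree[OF assms] by (simp add: tree_word_def)
qed

text \<open>Positions count from 0 here, as opposed to \<open>Rasc\<close>.\<close>

definition rascs :: "'a::linorder list \<Rightarrow> nat set" where
  "rascs xs = {p \<in> {..<length xs}. (\<forall>k<p. xs ! k < xs ! p) \<and>
    (Suc p = length xs \<or> (\<forall>k\<le>p. xs ! k < xs ! Suc p))}"

text \<open>The entry \<open>m\<close> is always a record and prevents later ones. It takes over the
  role of the end of the word for the last position of \<open>us\<close>, and is itself counted only
  if nothing follows.\<close>

lemma rascs_append_Cons:
  assumes "\<forall>x\<in>set us \<union> set vs. x < m"
  shows "rascs (us @ m # vs) = rascs us \<union> (if vs = [] then {length us} else {})"
proof (rule set_eqI)
  fix p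
  let ?w = "us @ m # vs"
  have us: "?w ! k = us ! k \<and> us ! k < m" if "k < length us" for k
    using that assms by (simp add: nth_append)
  have vs: "?w ! k < m" if "length us < k" "k < length ?w" for k
  proof -
    have "?w ! k = vs ! (k - Suc (length us))"
      using that by (simp add: nth_append nth_Cons')
    then show ?thesis using that assms by simp
  qed
  have m: "?w ! length us = m" by simp
  consider "Suc p < length us" | "Suc p = length us" | "p = length us" | "length us < p" by linarith
  then show "p \<in> rascs ?w \<longleftrightarrow> p \<in> rascs us \<union> (if vs = [] then {length us} else {})"
  proof cases
    case 1
    then show ?thesis using us by (auto simp: rascs_def)
  next
    case 2
    then have "?w ! Suc p = m" using m by simp
    then show ?thesis using 2 us by (auto simp: rascs_def)
  next
    case 3
    have "\<not> (\<forall>k\<le>p. ?w ! k < ?w ! Suc p)" if "vs \<noteq> []"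
      using vs[of "Suc p"] m 3 that by (auto simp: not_less intro!: exI[of _ p])
    then show ?thesis using 3 us m by (auto simp: rascs_def)
  next
    case 4
    have "\<not> (\<forall>k<p. ?w ! k < ?w ! p)" if "p < length ?w"
      using vs[of p] m 4 that by (auto simp: not_less intro!: exI[of _ "length us"])
    then show ?thesis using 4 by (auto simp: rascs_def)
  qed
qed

lemma tree_rasc_eq_card_rascs: "decreasing t \<Longrightarrow> tree_rasc t = card (rascs (inorder t))"
proof (induction t)
  case (Node l m r)
  have "finite (rascs (inorder l))" "length (inorder l) \<notin> rascs (inorder l)"
    by (auto simp: rascs_def)
  moreover have "inorder r = [] \<longleftrightarrow> r = Leaf" by (cases r) auto
  ultimately show ?case
    using Node by (simp add: rascs_append_Cons)
qed (simp add: rascs_def)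

lemma Rasc_of_one_line: "Rasc (length xs) (of_one_line xs) = card (rascs xs)"
proof -
  let ?u = "of_one_line xs" and ?n = "length xs"
  have u: "?u (Suc k) = xs ! k" if "k < ?n" for k
    using that by (simp add: of_one_line_def)
  have rec: "record_at ?u (Suc p) \<longleftrightarrow> (\<forall>k<p. xs ! k < xs ! p)" if "p < ?n" for p
  proof -
    have "{1..<Suc p} = Suc ` {..<p}" by (auto simp: image_iff Bex_def) presburger
    then show ?thesis using that u by (auto simp: record_at_def)
  qed
  have "{p \<in> {1..?n}. record_at ?u p \<and> (p = ?n \<or> record_at ?u (p + 1))} = Suc ` rascs xs"
  proof (rule set_eqI)
    fix q
    show "q \<in> {p \<in> {1..?n}. record_at ?u p \<and> (p = ?n \<or> record_at ?u (p + 1))} \<longleftrightarrow> q \<in> Suc ` rascs xs"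
    proof (cases q)
      case (Suc p)
      \<comment> \<open>At the final position there is no next entry, so \<open>rec\<close> does not
        apply to \<open>Suc p\<close> and the disjunct for the end of the word decides.\<close>
      consider "Suc p = ?n" | "Suc p < ?n" | "?n < Suc p" by linarith
      then have "Suc p \<in> {p \<in> {1..?n}. record_at ?u p \<and> (p = ?n \<or> record_at ?u (p + 1))} \<longleftrightarrow>
          p \<in> rascs xs"
        using rec[of p] rec[of "Suc p"] by cases (simp_all add: rascs_def less_Suc_eq_le)
      then show ?thesis by (simp add: Suc inj_image_mem_iff)
    qed auto
  qed
  then show ?thesis by (simp add: Rasc_def card_image)
qed

lemma Rasc_eq_tree_rasc:
  assumes "u \<in> Sym n"
  shows "Rasc n u = tree_rasc (word_tree n u)"
proof -
  let ?t = "word_tree n u"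
  have "Rasc n (of_one_line (inorder ?t)) = tree_rasc ?t"
    using Rasc_of_one_line[of "inorder ?t"] word_tree_in[OF assms]
      length_inorder_decreasing[OF word_tree_in[OF assms]] tree_rasc_eq_card_rascs[of ?t]
    by (simp only: decreasing_trees_def mem_Collect_eq)
  then show ?thesis using tree_word_word_tree[OF assms] by (simp add: tree_word_def)
qed

lemma Fix_eq_tree_rasc:
  assumes "w \<in> Sym n"
  shows "Fix n w = tree_rasc (word_tree n (renyi_foata n w))"
  using word_tree_in[OF renyi_foata_in[OF assms]] tree_perm_word_tree_renyi_foata[OF assms]
  by (simp add: Fix_def tree_rasc_eq_card_fixed decreasing_trees_def)

text \<open>The root is \<open>n\<close>, and its cycle is formed by \<open>n\<close> and the
  entries to its right in the image word. The cycle statistic thus becomes an order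
  statistic.\<close>

lemma same_cycle_max_iff_before:
  assumes "w \<in> Sym n" "i \<in> {1..n - 1}"
  shows "same_cycle i n w \<longleftrightarrow> before n i (word_tree n (renyi_foata n w))"
proof -
  define t where "t = word_tree n (renyi_foata n w)"
  have t: "decreasing t" "set_tree t = {1..n}" and w: "w = tree_perm t"
    using word_tree_in[OF renyi_foata_in[OF assms(1)]] tree_perm_word_tree_renyi_foata[OF assms(1)]
    by (simp_all add: decreasing_trees_def t_def)
  have n: "n \<in> set_tree t" "i \<in> set_tree t" "i \<noteq> n" using t(2) assms(2) by auto
  then obtain l m r where t_Node: "t = Node l m r" by (cases t) auto
  \<comment> \<open>The root is the largest label, and the labels are \<open>{1..n}\<close>.\<close>
  have "m \<in> {1..n}" using t(2) by (auto simp: t_Node)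
  moreover have "n = m \<or> n < m" using t(1) n(1) by (auto simp: t_Node)
  ultimately have m: "m = n" by auto
  have "same_cycle i n w \<longleftrightarrow> i \<in> insert m (set_tree r)"
    unfolding same_cycle_def w t_Node m[symmetric]
    by (rule root_in_orbit_tree_perm_iff) (use t n in \<open>simp_all add: t_Node\<close>)
  also have "\<dots> \<longleftrightarrow> before n i t"
    using n t(1) before_in_set[of n i l] before_in_set[of n i r] by (auto simp: t_Node m)
  finally show ?thesis by (simp add: t_def)
qed

lemma twist_conjugate_phi: "twist_conjugate n (phi n) (Sym n) (word_tree n)"
  by unfold_locales (simp_all add: finite_Sym phi_in inj_on_word_tree word_tree_in word_tree_phi)

lemma twist_conjugate_phi_bar:
  "twist_conjugate n (phi_bar n) (Sym n) (\<lambda>w. word_tree n (renyi_foata n w))"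
proof
  show "inj_on (\<lambda>w. word_tree n (renyi_foata n w)) (Sym n)"
    using tree_perm_word_tree_renyi_foata by (rule inj_on_inverseI)
qed (simp_all add: finite_Sym phi_bar_in word_tree_in renyi_foata_in renyi_foata_phi_bar word_tree_phi)

section \<open>The greatest common divisor of the orbit sizes\<close>

lemma Gcd_card_orbit_phi:
  assumes "n \<ge> 1"
  shows "Gcd {card (orbit (phi n) w) | w. w \<in> Sym n} = Max {m. m \<le> n \<and> (\<exists>k. m = 2 ^ k)}"
proof -
  interpret twist_conjugate n "phi n" "Sym n" "word_tree n" by (rule twist_conjugate_phi)
  obtain h where h: "2 ^ h \<le> n" "n < 2 ^ Suc h"
    using ex_power_ivl1[of 2 n] assms by auto
  have "Max {m. m \<le> n \<and> (\<exists>k. m = 2 ^ k)} = 2 ^ h"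
  proof (rule Max_eqI)
    show "finite {m. m \<le> n \<and> (\<exists>k. m = 2 ^ k)}"
      by (rule finite_subset[of _ "{..n}"]) auto
    fix m assume "m \<in> {m. m \<le> n \<and> (\<exists>k. m = 2 ^ k)}"
    then obtain k where m: "m = 2 ^ k" "m \<le> n" by blast
    then have "(2::nat) ^ k < 2 ^ Suc h" using h(2) by linarith
    then have "k \<le> h" by (simp only: power_strict_increasing_iff one_less_numeral_iff semiring_norm less_Suc_eq_le)
    then show "m \<le> 2 ^ h" using m by simp
  qed (use h in blast)
  moreover have "2 ^ h dvd card (orbit (phi n) w)" if "w \<in> Sym n" for w
  proof -
    let ?t = "word_tree n w"
    \<comment> \<open>A tree of height \<open>H\<close> has at most \<open>2 ^ H - 1\<close> nodes,
      so \<open>n \<ge> 2 ^ h\<close> forces height at least \<open>h + 1\<close>.\<close>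
    have "size1 ?t = n + 1"
      using length_inorder_decreasing[OF word_tree_in[OF that]] by (simp add: size1_size)
    then have "2 ^ h < (2::nat) ^ height ?t"
      using size1_height[of ?t] h(1) by linarith
    then have "h < height ?t" by (rule power_less_imp_less_exp[rotated]) simp
    then show ?thesis using card_orbit[OF that] by (simp add: le_imp_power_dvd)
  qed
  \<comment> \<open>A balanced tree has height at most \<open>h + 1\<close>, so its orbit size
    divides the common divisor \<open>2 ^ h\<close>.\<close>
  moreover have "\<exists>w\<in>Sym n. card (orbit (phi n) w) dvd 2 ^ h"
  proof -
    obtain t where t: "decreasing t" "set_tree t = {1..n}" "height t \<le> Suc h"
      using ex_decreasing_tree[of "{1..n}" "Suc h"] h(2) by auto
    then have "t \<in> decreasing_trees n" by (simp add: decreasing_trees_def)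
    then have "tree_word t \<in> Sym n" "card (orbit (phi n) (tree_word t)) = 2 ^ (height t - 1)"
      by (simp_all add: tree_word_in card_orbit word_tree_tree_word)
    then show ?thesis using t(3) by (intro bexI[of _ "tree_word t"]) (auto intro: le_imp_power_dvd)
  qed
  ultimately show ?thesis
    by (intro dvd_antisym) (auto intro!: Gcd_greatest intro: dvd_trans[OF Gcd_dvd])
qed

theorem theorem2p8:
  fixes n :: nat
  assumes "n \<ge> 1"
  shows
    "(bij_betw (renyi_foata n) (Sym n) (Sym n) \<and>
      bij_betw (phi n) (Sym n) (Sym n) \<and>
      bij_betw (phi_bar n) (Sym n) (Sym n) \<and>
      (\<forall>w\<in>Sym n. phi_bar n w = renyi_foata_inv n (phi n (renyi_foata n w)))) \<and>
     ((\<forall>w\<in>Sym n. \<exists>k. card (orbit (phi n) w) = 2 ^ k) \<and>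
      (\<forall>w\<in>Sym n. \<exists>k. card (orbit (phi_bar n) w) = 2 ^ k) \<and>
      (\<forall>w\<in>Sym n. card (orbit (phi n) w) = 2 ^ edge_height (heap_of (one_line n w))) \<and>
      Gcd {card (orbit (phi n) w) | w. w \<in> Sym n} = Max {m. m \<le> n \<and> (\<exists>k. m = 2 ^ k)}) \<and>
     (mesic 1 (phi_bar n) (Sym n) (\<lambda>w. of_nat (Fix n w)) \<and>
      mesic 1 (phi n) (Sym n) (\<lambda>u. of_nat (Rasc n u))) \<and>
     (\<forall>i\<in>{1..n}. \<forall>j\<in>{1..n}. i \<noteq> j \<longrightarrow>
        mesic (1/2) (phi n) (Sym n) (\<lambda>u. of_bool (left_of n i j u))) \<and>
     (\<forall>i\<in>{1..n - 1}.
        mesic (1/2) (phi_bar n) (Sym n) (\<lambda>w. of_bool (same_cycle i n w)))"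
proof -
  interpret phi: twist_conjugate n "phi n" "Sym n" "word_tree n"
    by (rule twist_conjugate_phi)
  interpret phi_bar: twist_conjugate n "phi_bar n" "Sym n" "\<lambda>w. word_tree n (renyi_foata n w)"
    by (rule twist_conjugate_phi_bar)
  have "phi_bar n w = renyi_foata_inv n (phi n (renyi_foata n w))" if "w \<in> Sym n" for w
    using that renyi_foata_inv_renyi_foata phi_bar_in renyi_foata_phi_bar by metis
  moreover have "card (orbit (phi n) w) = 2 ^ edge_height (heap_of (one_line n w))"
    if "w \<in> Sym n" for w
  proof -
    \<comment> \<open>The bound \<open>n \<ge> 1\<close> rules out the empty tree, on which
      \<open>edge_height\<close> is not meaningful.\<close>
    have "word_tree n w \<noteq> Leaf"
      using word_tree_in[OF that] assms by (auto simp: decreasing_trees_def)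
    then show ?thesis
      using phi.card_orbit[OF that] edge_height_eq[of "word_tree n w"] by (simp add: word_tree_def)
  qed
  moreover have "mesic 1 (phi_bar n) (Sym n) (\<lambda>w. of_nat (Fix n w))"
    by (rule phi_bar.mesicI[where g = tree_rasc])
      (use assms sum_tree_rasc_rat in \<open>simp_all add: Fix_eq_tree_rasc\<close>)
  moreover have "mesic 1 (phi n) (Sym n) (\<lambda>u. of_nat (Rasc n u))"
    by (rule phi.mesicI[where g = tree_rasc])
      (use assms sum_tree_rasc_rat in \<open>simp_all add: Rasc_eq_tree_rasc\<close>)
  moreover have "mesic (1/2) (phi n) (Sym n) (\<lambda>u. of_bool (left_of n i j u))"
    if "i \<in> {1..n}" "j \<in> {1..n}" "i \<noteq> j" for i j
    by (rule phi.mesicI[where g = "\<lambda>t. of_bool (before i j t)", OF _ sum_before_rat[OF _ that]])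
      (simp_all add: left_of_iff_before)
  \<comment> \<open>This is the order statistic of the pair \<open>n\<close>, \<open>i\<close>,
    evaluated on the image under \<open>renyi_foata n\<close>.\<close>
  moreover have "mesic (1/2) (phi_bar n) (Sym n) (\<lambda>w. of_bool (same_cycle i n w))"
    if "i \<in> {1..n - 1}" for i
    by (rule phi_bar.mesicI[where g = "\<lambda>t. of_bool (before n i t)", OF _ sum_before_rat])
      (use that in \<open>auto simp: same_cycle_max_iff_before\<close>)
  ultimately show ?thesis
    using bij_betw_renyi_foata phi.bij phi_bar.bij phi.card_orbit phi_bar.card_orbit
      Gcd_card_orbit_phi[OF assms]
    by (intro conjI ballI impI) blast+
qed

end
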